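(* Let $c$ be a well-formed GCL command and $f$ a label with $\mathsf{okf}(c,f)$, let $pc$ be a variable not occurring in $c$, and let $gcs$ satisfy $c\triangleright_f gcs$ (normal form body for the variable $pc$). Let $n=\mathsf{lab}(c)$. Then $$pc:=n;\ \mathsf{do}\ gcs\ \mathsf{od}\ \cong\ \mathsf{add}^{pc}(c);\ pc:=f .$$
   Context: GCL commands: $c ::= \mathsf{skip}^n \mid x :=^n e \mid c;c \mid \mathsf{if}^n\, gcs\,\mathsf{fi} \mid \mathsf{do}^n\, gcs\,\mathsf{od}$, $gcs ::= e\to c \mid e\to c \,\square\, gcs$, over integer variables, $n\in\mathbb{Z}$ labels, boolean expressions built from primitive boolean expressions by $\wedge,\vee,\neg$. $\mathsf{enab}(gcs)$ is the disjunction of the guards. A command is well formed if well typed and every subcommand $\mathsf{if}^n gcs\,\mathsf{fi}$ has $\mathsf{enab}(gcs)$ true in every store. $\mathsf{lab}(c)$ is the label of $c$ ($\mathsf{lab}(c;d)=\mathsf{lab}(c)$), $\mathsf{labs}(c)$ the set of labels in $c$; $\mathsf{okf}(c,f)$ means all labels in $c$ are positive and pairwise distinct and $f\notin\mathsf{labs}(c)$. Abbreviations for a chosen variable $pc$: $!n$ is the assignment $pc:=n$ (with arbitrary label, e.g. 0) and $?n$ is the boolean expression $pc=n$. Instrumentation $\mathsf{add}^{pc}$: $\mathsf{add}^{pc}(\mathsf{skip}^n)=!n;\mathsf{skip}^n$; $\mathsf{add}^{pc}(x:=^ne)=!n;x:=^ne$; $\mathsf{add}^{pc}(c;d)=\mathsf{add}^{pc}(c);\mathsf{add}^{pc}(d)$;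 $\mathsf{add}^{pc}(\mathsf{if}^n gcs\,\mathsf{fi})=!n;\mathsf{if}^n gcs_0\,\mathsf{fi}$ where $gcs_0$ replaces each $e\to d$ of $gcs$ by $e\to\mathsf{add}^{pc}(d)$; $\mathsf{add}^{pc}(\mathsf{do}^n gcs\,\mathsf{od})=!n;\mathsf{do}^n gcs_1\,\mathsf{od}$ where $gcs_1$ replaces each $e\to d$ by $e\to\mathsf{add}^{pc}(d);!n$. Normal form bodies $c\triangleright_f gcs$ (inductively): $\mathsf{skip}^n\triangleright_f (?n\to !f)$; $x:=^ne\triangleright_f(?n\to x:=e;!f)$; if $c\triangleright_{\mathsf{lab}(d)}gcs_0$ and $d\triangleright_f gcs_1$ then $c;d\triangleright_f gcs_0\,\square\,gcs_1$; for $\mathsf{if}^n gcs\,\mathsf{fi}$ with $gcs=e_1\to d_1\,\square\cdots\square\,e_k\to d_k$ and $d_i\triangleright_f g_i$: $\mathsf{if}^n gcs\,\mathsf{fi}\triangleright_f (?n\wedge e_1\to !\mathsf{lab}(d_1))\square\cdots\square(?n\wedge e_k\to !\mathsf{lab}(d_k))\square g_1\square\cdots\square g_k$; for $\mathsf{do}^n gcs\,\mathsf{od}$ with the same shape and $d_i\triangleright_n g_i$: $\mathsf{do}^n gcs\,\mathsf{od}\triangleright_f (?n\wedge e_1\to !\mathsf{lab}(d_1))\square\cdots\square(?n\wedge e_k\to !\mathsf{lab}(d_k))\square(?n\wedge\neg\mathsf{enab}(gcs)\to !f)\square g_1\square\cdots\square g_k$. Command equivalence $c\cong d$ means $\mathrm{Hyp}\vdash\mathcal{K}(c)=\mathcal{K}(d)$,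 provability in Kleene algebra with tests (KAT): a KAT is $(K,B,+,;,*,\neg,1,0)$ with $B\subseteq K$ a Boolean algebra (with $1$ true, $;$ as conjunction, $+$ disjunction, $\neg$ complement), $K$ an idempotent semiring, and $1+x;x^*=x^*$, $1+x^*;x=x^*$, $y+x;z\le z\Rightarrow x^*;y\le z$, $y+z;x\le z\Rightarrow y;x^*\le z$, where $x\le y$ iff $x+y=y$; $H\vdash E_0=E_1$ means derivable by equational and propositional reasoning from the KAT axioms and the equations $H$. KAT expressions have atoms $\underline{b}$ (primitive boolean expressions, as tests) and $\underline{x:=e}$ (assignments). Translation: $\mathcal{K}(b)=\underline{b}$, $\mathcal{K}(e\wedge e')=\mathcal{K}(e);\mathcal{K}(e')$, $\mathcal{K}(e\vee e')=\mathcal{K}(e)+\mathcal{K}(e')$, $\mathcal{K}(\neg e)=\neg\mathcal{K}(e)$, $\mathcal{K}(x:=e)=\underline{x:=e}$, $\mathcal{K}(\mathsf{skip})=1$, $\mathcal{K}(c;d)=\mathcal{K}(c);\mathcal{K}(d)$, $\mathcal{K}(gcs)=\sum_{e\to c\in gcs}\mathcal{K}(e);\mathcal{K}(c)$, $\mathcal{K}(\mathsf{if}\,gcs\,\mathsf{fi})=\mathcal{K}(gcs)$, $\mathcal{K}(\mathsf{do}\,gcs\,\mathsf{od})=\mathcal{K}(gcs)^*;\neg\mathcal{K}(\mathsf{enab}(gcs))$ (labels ignored). $\mathrm{Hyp}$ is the set of equations $\mathcal{K}(e)=0$ for every boolean expression $e$ that is false in every store, and $\mathcal{K}(e_0);\underline{x:=e};\neg\mathcal{K}(e_1)=0$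 for all $x,e,e_0,e_1$ such that every store satisfying $e_0$ satisfies $e_1$ after updating $x$ to the value of $e$. *)

theory Defs
  imports Main
begin

section \<open>Expressions\<close>

text \<open>Expressions are those over an arbitrary signature: function symbols \<open>'f\<close>, predicate
  symbols \<open>'r\<close>, interpreted by \<open>I\<close> and \<open>J\<close> below.  An interpretation is total on argument lists
  of every length and all variables are integer variables, so every command is well typed.\<close>

type_synonym 'v store = "'v \<Rightarrow> int"

datatype (vars_iexp: 'v, 'f) iexp =
  Const int | Var 'v | App 'f "('v, 'f) iexp list"

datatype (vars_prim: 'v, 'f, 'r) prim =
  Eq "('v, 'f) iexp" "('v, 'f) iexp" | Rel 'r "('v, 'f) iexp list"

datatype 'p bexp =
  Prim 'p | BAnd "'p bexp" "'p bexp" | BOr "'p bexp" "'p bexp" | BNot "'p bexp"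

fun ival :: "('f \<Rightarrow> int list \<Rightarrow> int) \<Rightarrow> ('v, 'f) iexp \<Rightarrow> 'v store \<Rightarrow> int" where
  "ival I (Const n) s = n"
| "ival I (Var x) s = s x"
| "ival I (App g es) s = I g (map (\<lambda>e. ival I e s) es)"

fun pval :: "('f \<Rightarrow> int list \<Rightarrow> int) \<Rightarrow> ('r \<Rightarrow> int list \<Rightarrow> bool) \<Rightarrow>
    ('v, 'f, 'r) prim \<Rightarrow> 'v store \<Rightarrow> bool" where
  "pval I J (Eq e e') s \<longleftrightarrow> ival I e s = ival I e' s"
| "pval I J (Rel r es) s \<longleftrightarrow> J r (map (\<lambda>e. ival I e s) es)"

fun bval :: "('f \<Rightarrow> int list \<Rightarrow> int) \<Rightarrow> ('r \<Rightarrow> int list \<Rightarrow> bool) \<Rightarrow>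
    ('v, 'f, 'r) prim bexp \<Rightarrow> 'v store \<Rightarrow> bool" where
  "bval I J (Prim p) s \<longleftrightarrow> pval I J p s"
| "bval I J (BAnd e e') s \<longleftrightarrow> bval I J e s \<and> bval I J e' s"
| "bval I J (BOr e e') s \<longleftrightarrow> bval I J e s \<or> bval I J e' s"
| "bval I J (BNot e) s \<longleftrightarrow> \<not> bval I J e s"

section \<open>Guarded commands\<close>

text \<open>\<open>gcs\<close> is rendered as a list of guard/command pairs, \<open>\<box>\<close> being append; the grammar only has
  nonempty \<open>gcs\<close>, which is imposed in \<open>well_formed\<close>.  The generated set function \<open>vars_com\<close>
  collects all variables occurring in a command, in expressions or as assignment targets.\<close>

datatype (vars_com: 'v, 'f, 'r) com =
  Skip int
| Assign int 'v "('v, 'f) iexp"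
| Seq "('v, 'f, 'r) com" "('v, 'f, 'r) com"
| If int "(('v, 'f, 'r) prim bexp \<times> ('v, 'f, 'r) com) list"
| Do int "(('v, 'f, 'r) prim bexp \<times> ('v, 'f, 'r) com) list"

type_synonym ('v, 'f, 'r) gcs = "(('v, 'f, 'r) prim bexp \<times> ('v, 'f, 'r) com) list"

text \<open>Unspecified on the empty list, as the language has no constant for false.\<close>

fun disj :: "'p bexp list \<Rightarrow> 'p bexp" where
  "disj [e] = e"
| "disj (e # e' # es) = BOr e (disj (e' # es))"

definition enab :: "('v, 'f, 'r) gcs \<Rightarrow> ('v, 'f, 'r) prim bexp" where
  "enab gcs = disj (map fst gcs)"

fun well_formed :: "('f \<Rightarrow> int list \<Rightarrow> int) \<Rightarrow> ('r \<Rightarrow> int list \<Rightarrow> bool) \<Rightarrow>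
    ('v, 'f, 'r) com \<Rightarrow> bool" where
  "well_formed I J (Skip n) \<longleftrightarrow> True"
| "well_formed I J (Assign n x e) \<longleftrightarrow> True"
| "well_formed I J (Seq c d) \<longleftrightarrow> well_formed I J c \<and> well_formed I J d"
| "well_formed I J (If n gcs) \<longleftrightarrow>
     gcs \<noteq> [] \<and> (\<forall>s. bval I J (enab gcs) s) \<and> (\<forall>(e, d) \<in> set gcs. well_formed I J d)"
| "well_formed I J (Do n gcs) \<longleftrightarrow>
     gcs \<noteq> [] \<and> (\<forall>(e, d) \<in> set gcs. well_formed I J d)"

fun lab :: "('v, 'f, 'r) com \<Rightarrow> int" where
  "lab (Skip n) = n"
| "lab (Assign n x e) = n"
| "lab (Seq c d) = lab c"
| "lab (If n gcs) = n"
| "lab (Do n gcs) = n"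

text \<open>All label occurrences, with repetitions.\<close>

fun label_list :: "('v, 'f, 'r) com \<Rightarrow> int list" where
  "label_list (Skip n) = [n]"
| "label_list (Assign n x e) = [n]"
| "label_list (Seq c d) = label_list c @ label_list d"
| "label_list (If n gcs) = n # concat (map (\<lambda>(e, d). label_list d) gcs)"
| "label_list (Do n gcs) = n # concat (map (\<lambda>(e, d). label_list d) gcs)"

definition labs :: "('v, 'f, 'r) com \<Rightarrow> int set" where
  "labs c = set (label_list c)"

definition okf :: "('v, 'f, 'r) com \<Rightarrow> int \<Rightarrow> bool" where
  "okf c f \<longleftrightarrow> (\<forall>n \<in> labs c. 0 < n) \<and> distinct (label_list c) \<and> f \<notin> labs c"

section \<open>Instrumentation and normal form bodies\<close>

text \<open>\<open>goto pc n\<close> is \<open>!n\<close> and \<open>at pc n\<close> is \<open>?n\<close>.  Labels that the mathematics leaves arbitrary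
  are 0 throughout.\<close>

definition goto :: "'v \<Rightarrow> int \<Rightarrow> ('v, 'f, 'r) com" where
  "goto pc n = Assign 0 pc (Const n)"

definition at :: "'v \<Rightarrow> int \<Rightarrow> ('v, 'f, 'r) prim bexp" where
  "at pc n = Prim (Eq (Var pc) (Const n))"

fun add :: "'v \<Rightarrow> ('v, 'f, 'r) com \<Rightarrow> ('v, 'f, 'r) com" where
  "add pc (Skip n) = Seq (goto pc n) (Skip n)"
| "add pc (Assign n x e) = Seq (goto pc n) (Assign n x e)"
| "add pc (Seq c d) = Seq (add pc c) (add pc d)"
| "add pc (If n gcs) = Seq (goto pc n) (If n (map (\<lambda>(e, d). (e, add pc d)) gcs))"
| "add pc (Do n gcs) =
     Seq (goto pc n) (Do n (map (\<lambda>(e, d). (e, Seq (add pc d) (goto pc n))) gcs))"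

definition branches :: "'v \<Rightarrow> int \<Rightarrow> ('v, 'f, 'r) gcs \<Rightarrow> ('v, 'f, 'r) gcs" where
  "branches pc n gcs = map (\<lambda>(e, d). (BAnd (at pc n) e, goto pc (lab d))) gcs"

text \<open>\<open>nf pc c f gcs\<close> is \<open>c \<triangleright>\<^sub>f gcs\<close>.\<close>

inductive nf :: "'v \<Rightarrow> ('v, 'f, 'r) com \<Rightarrow> int \<Rightarrow> ('v, 'f, 'r) gcs \<Rightarrow> bool" for pc :: 'v where
  nf_Skip: "nf pc (Skip n) f [(at pc n, goto pc f)]"
| nf_Assign: "nf pc (Assign n x e) f [(at pc n, Seq (Assign 0 x e) (goto pc f))]"
| nf_Seq: "nf pc c (lab d) gcs0 \<Longrightarrow> nf pc d f gcs1 \<Longrightarrow> nf pc (Seq c d) f (gcs0 @ gcs1)"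
| nf_If: "list_all2 (\<lambda>d g. nf pc d f g) (map snd gcs) gs \<Longrightarrow>
    nf pc (If n gcs) f (branches pc n gcs @ concat gs)"
| nf_Do: "list_all2 (\<lambda>d g. nf pc d n g) (map snd gcs) gs \<Longrightarrow>
    nf pc (Do n gcs) f
      (branches pc n gcs @ [(BAnd (at pc n) (BNot (enab gcs)), goto pc f)] @ concat gs)"

section \<open>Kleene algebra with tests\<close>

datatype ('t, 'a) kat =
  KTest 't | KAct 'a | KZero | KOne
| KPlus "('t, 'a) kat" "('t, 'a) kat"
| KSeq "('t, 'a) kat" "('t, 'a) kat"
| KStar "('t, 'a) kat"
| KNot "('t, 'a) kat"

inductive is_test :: "('t, 'a) kat \<Rightarrow> bool" where
  "is_test (KTest p)"
| "is_test KZero"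
| "is_test KOne"
| "is_test a \<Longrightarrow> is_test b \<Longrightarrow> is_test (KPlus a b)"
| "is_test a \<Longrightarrow> is_test b \<Longrightarrow> is_test (KSeq a b)"
| "is_test a \<Longrightarrow> is_test (KNot a)"

text \<open>Derivability from the KAT axioms and the equations \<open>H\<close>.  All axioms are equations or
  implications between equations, so equational and propositional reasoning amounts to the
  congruence rules together with the implications read as inference rules; \<open>x \<le> y\<close> is written
  out as \<open>x + y = y\<close>.  Together with the semiring axioms, the \<open>test_\<close> rules are
  Huntington's axioms for Boolean algebras.  Nothing is assumed about \<open>KNot x\<close> for \<open>x\<close> not a
  test, beyond congruence; in models it may be read as an arbitrary totalization of negation.\<close>

inductive kat_derivable ::
    "(('t, 'a) kat \<times> ('t, 'a) kat) set \<Rightarrow> ('t, 'a) kat \<Rightarrow> ('t, 'a) kat \<Rightarrow> bool"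
    ("(_ \<turnstile>/ _ \<approx>/ _)" [51, 51, 51] 50)
  for H :: "(('t, 'a) kat \<times> ('t, 'a) kat) set" where
  hyp: "(x, y) \<in> H \<Longrightarrow> H \<turnstile> x \<approx> y"
| refl: "H \<turnstile> x \<approx> x"
| sym: "H \<turnstile> x \<approx> y \<Longrightarrow> H \<turnstile> y \<approx> x"
| trans: "H \<turnstile> x \<approx> y \<Longrightarrow> H \<turnstile> y \<approx> z \<Longrightarrow> H \<turnstile> x \<approx> z"
| cong_plus: "H \<turnstile> x \<approx> x' \<Longrightarrow> H \<turnstile> y \<approx> y' \<Longrightarrow> H \<turnstile> KPlus x y \<approx> KPlus x' y'"
| cong_seq: "H \<turnstile> x \<approx> x' \<Longrightarrow> H \<turnstile> y \<approx> y' \<Longrightarrow> H \<turnstile> KSeq x y \<approx> KSeq x' y'"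
| cong_star: "H \<turnstile> x \<approx> x' \<Longrightarrow> H \<turnstile> KStar x \<approx> KStar x'"
| cong_not: "H \<turnstile> x \<approx> x' \<Longrightarrow> H \<turnstile> KNot x \<approx> KNot x'"
| plus_assoc: "H \<turnstile> KPlus (KPlus x y) z \<approx> KPlus x (KPlus y z)"
| plus_comm: "H \<turnstile> KPlus x y \<approx> KPlus y x"
| plus_zero: "H \<turnstile> KPlus x KZero \<approx> x"
| plus_idem: "H \<turnstile> KPlus x x \<approx> x"
| seq_assoc: "H \<turnstile> KSeq (KSeq x y) z \<approx> KSeq x (KSeq y z)"
| one_seq: "H \<turnstile> KSeq KOne x \<approx> x"
| seq_one: "H \<turnstile> KSeq x KOne \<approx> x"
| zero_seq: "H \<turnstile> KSeq KZero x \<approx> KZero"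
| seq_zero: "H \<turnstile> KSeq x KZero \<approx> KZero"
| distrib_left: "H \<turnstile> KSeq x (KPlus y z) \<approx> KPlus (KSeq x y) (KSeq x z)"
| distrib_right: "H \<turnstile> KSeq (KPlus x y) z \<approx> KPlus (KSeq x z) (KSeq y z)"
| star_unfold_left: "H \<turnstile> KPlus KOne (KSeq x (KStar x)) \<approx> KStar x"
| star_unfold_right: "H \<turnstile> KPlus KOne (KSeq (KStar x) x) \<approx> KStar x"
| star_induct_left:
    "H \<turnstile> KPlus (KPlus y (KSeq x z)) z \<approx> z \<Longrightarrow> H \<turnstile> KPlus (KSeq (KStar x) y) z \<approx> z"
| star_induct_right:
    "H \<turnstile> KPlus (KPlus y (KSeq z x)) z \<approx> z \<Longrightarrow> H \<turnstile> KPlus (KSeq y (KStar x)) z \<approx> z"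
| test_seq_comm: "is_test a \<Longrightarrow> is_test b \<Longrightarrow> H \<turnstile> KSeq a b \<approx> KSeq b a"
| test_distrib: "is_test a \<Longrightarrow> is_test b \<Longrightarrow> is_test c \<Longrightarrow>
    H \<turnstile> KPlus a (KSeq b c) \<approx> KSeq (KPlus a b) (KPlus a c)"
| test_compl_seq: "is_test a \<Longrightarrow> H \<turnstile> KSeq a (KNot a) \<approx> KZero"
| test_compl_plus: "is_test a \<Longrightarrow> H \<turnstile> KPlus a (KNot a) \<approx> KOne"

section \<open>Command equivalence\<close>

type_synonym ('v, 'f, 'r) kexp = "(('v, 'f, 'r) prim, 'v \<times> ('v, 'f) iexp) kat"

fun kat_bexp :: "('v, 'f, 'r) prim bexp \<Rightarrow> ('v, 'f, 'r) kexp" where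
  "kat_bexp (Prim p) = KTest p"
| "kat_bexp (BAnd e e') = KSeq (kat_bexp e) (kat_bexp e')"
| "kat_bexp (BOr e e') = KPlus (kat_bexp e) (kat_bexp e')"
| "kat_bexp (BNot e) = KNot (kat_bexp e)"

definition ksum :: "('t, 'a) kat list \<Rightarrow> ('t, 'a) kat" where
  "ksum xs = foldr KPlus xs KZero"

fun kat_com :: "('v, 'f, 'r) com \<Rightarrow> ('v, 'f, 'r) kexp" where
  "kat_com (Skip n) = KOne"
| "kat_com (Assign n x e) = KAct (x, e)"
| "kat_com (Seq c d) = KSeq (kat_com c) (kat_com d)"
| "kat_com (If n gcs) = ksum (map (\<lambda>(e, d). KSeq (kat_bexp e) (kat_com d)) gcs)"
| "kat_com (Do n gcs) =
     KSeq (KStar (ksum (map (\<lambda>(e, d). KSeq (kat_bexp e) (kat_com d)) gcs)))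
          (KNot (kat_bexp (enab gcs)))"

definition Hyp :: "('f \<Rightarrow> int list \<Rightarrow> int) \<Rightarrow> ('r \<Rightarrow> int list \<Rightarrow> bool) \<Rightarrow>
    (('v, 'f, 'r) kexp \<times> ('v, 'f, 'r) kexp) set" where
  "Hyp I J =
     {(kat_bexp e, KZero) | e. \<forall>s. \<not> bval I J e s} \<union>
     {(KSeq (KSeq (kat_bexp e0) (KAct (x, e))) (KNot (kat_bexp e1)), KZero) | x e e0 e1.
        \<forall>s. bval I J e0 s \<longrightarrow> bval I J e1 (s(x := ival I e s))}"

definition com_equiv :: "('f \<Rightarrow> int list \<Rightarrow> int) \<Rightarrow> ('r \<Rightarrow> int list \<Rightarrow> bool) \<Rightarrow>
    ('v, 'f, 'r) com \<Rightarrow> ('v, 'f, 'r) com \<Rightarrow> bool" where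
  "com_equiv I J c d \<longleftrightarrow> Hyp I J \<turnstile> kat_com c \<approx> kat_com d"

end

theory Submission
  imports Defs
begin

text \<open>Assigning to \<open>pc\<close> establishes the corresponding test, so a normal form body is a block system:
  each fragment has a set of labels from which it runs, and it only jumps inside that set or to its
  exit.  In Kleene algebra, disjointness of the label sets turns the star of a sum of bodies into a
  product of stars (sequence), into a choice of one star (conditional), or, by denesting and sliding,
  into a star of stars (loop); well-formedness of conditionals makes the loop guard of the body
  equivalent to "\<open>pc\<close> is one of the labels".  The argument takes place in an arbitrary KAT model of
  \<open>Hyp\<close>; a term model turns the resulting equation into a derivation.\<close>

section \<open>Kleene algebra with tests\<close>

text \<open>The base classes do not force 0 and 1 to differ, so the term model needs no consistency
  proof. Tests are singled out by a predicate, and \<open>neg\<close> is constrained only on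
  them.\<close>

class kat_algebra = semiring_0 + monoid_mult +
  fixes star :: "'a \<Rightarrow> 'a"
    and neg :: "'a \<Rightarrow> 'a"
    and test :: "'a \<Rightarrow> bool"
  assumes add_idem: "x + x = x"
    and star_left: "1 + x * star x = star x"
    and star_right: "1 + star x * x = star x"
    and star_left_induct: "y + x * z + z = z \<Longrightarrow> star x * y + z = z"
    and star_right_induct: "y + z * x + z = z \<Longrightarrow> y * star x + z = z"
    and test_zero: "test 0"
    and test_one: "test 1"
    and test_add: "test a \<Longrightarrow> test b \<Longrightarrow> test (a + b)"
    and test_mult: "test a \<Longrightarrow> test b \<Longrightarrow> test (a * b)"
    and test_neg: "test a \<Longrightarrow> test (neg a)"
    and test_commute: "test a \<Longrightarrow> test b \<Longrightarrow> a * b = b * a"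
    and test_add_distrib: "test a \<Longrightarrow> test b \<Longrightarrow> test c \<Longrightarrow> a + b * c = (a + b) * (a + c)"
    and test_mult_neg: "test a \<Longrightarrow> a * neg a = 0"
    and test_add_neg: "test a \<Longrightarrow> a + neg a = 1"
begin

section \<open>Laws of star\<close>

lemma add_idem_left: "x + (x + y) = x + y"
  by (metis add.assoc add_idem)

lemmas add_aci = add.assoc add.commute add.left_commute add_idem add_idem_left

text \<open>Two star inductions: the assumption makes \<open>star y * a\<close> closed under
  \<open>x\<close> on the right and \<open>a * star x\<close> closed under \<open>y\<close> on the
  left.\<close>

lemma star_bisimulation:
  assumes "a * x = y * a"
  shows "a * star x = star y * a"
proof -
  have "a + star y * a * x = star y * a"
    by (metis assms distrib_right mult.assoc mult_1_left star_right)
  hence "a * star x + star y * a = star y * a"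
    by (intro star_right_induct) (simp add: add_idem)
  moreover have "a + y * (a * star x) = a * star x"
    by (metis assms distrib_left mult.assoc mult_1_right star_left)
  hence "star y * a + a * star x = a * star x"
    by (intro star_left_induct) (simp add: add_idem)
  ultimately show ?thesis by (metis add.commute)
qed

lemma star_zero: "star 0 = 1"
  by (metis add_0_right mult_zero_left star_left)

lemma mult_star_annihilate: "a * x = 0 \<Longrightarrow> a * star x = a"
  using star_bisimulation[of a x 0] by (simp add: star_zero)

lemma star_sliding: "star (x * y) * x = x * star (y * x)"
  using star_bisimulation[of x "y * x" "x * y"] by (simp add: mult.assoc)

lemma one_star: "1 + star x = star x"
  by (metis add_idem_left star_left)

text \<open>Denesting. The left side \<open>w\<close> absorbs \<open>a\<close> and \<open>b\<close>
  on the right, hence \<open>star a\<close> and then \<open>b * star a\<close>; conversely, the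
  right side absorbs \<open>a + b\<close> on the left.\<close>

lemma star_add: "star (a + b) = star a * star (b * star a)"
proof -
  define w where "w = star (a + b)"
  define v where "v = star (b * star a)"
  have w1: "1 + w = w" unfolding w_def by (rule one_star)
  have "w = 1 + w * (a + b)" unfolding w_def by (simp add: star_right)
  hence w: "w = 1 + w * a + w * b" by (simp add: distrib_left add.assoc)
  have wa: "w * a + w = w" and wb: "w * b + w = w"
    using w by (metis add_aci)+
  have "w * b + w * a + w = w" by (simp add: add.assoc wa wb)
  hence wba: "w * b * star a + w = w" by (rule star_right_induct)
  have "1 + w * a + w = w" by (simp add: add.assoc wa w1)
  hence "1 * star a + w = w" by (rule star_right_induct)
  hence "star a + w * (b * star a) + w = w"
    using wba by (simp add: add.assoc mult.assoc)
  hence 1: "star a * v + w = w" unfolding v_def by (rule star_right_induct)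
  have v: "1 + b * star a * v = v" unfolding v_def by (rule star_left)
  have a: "v + a * (star a * v) = star a * v"
    by (metis distrib_right mult.assoc mult_1_left star_left)
  hence "1 + (a + b) * (star a * v) + star a * v = star a * v"
    using v by (metis (no_types, lifting) add_aci distrib_right mult.assoc)
  hence "w * 1 + star a * v = star a * v" unfolding w_def by (rule star_left_induct)
  thus ?thesis using 1 by (metis add.commute mult_1_right v_def w_def)
qed

text \<open>No \<open>a\<close> can follow a \<open>b\<close>, so the factor
  \<open>b * star a\<close> in the denesting law shrinks to \<open>b\<close>.\<close>

lemma star_add_annihilate: "b * a = 0 \<Longrightarrow> star (a + b) = star a * star b"
  by (simp add: star_add mult_star_annihilate)

lemma star_nilpotent: "x * x = 0 \<Longrightarrow> star x = 1 + x"
  by (metis mult_star_annihilate star_left)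

text \<open>Both assumptions yield bisimulations along \<open>t\<close>, so both sides equal
  \<open>star (t * u) * t\<close>. This replaces a loop by one that agrees with it below an
  invariant \<open>t\<close>.\<close>

lemma star_restrict:
  assumes "t * s = t * u" "t * u = t * u * t"
  shows "t * star s = t * star u"
  by (metis assms star_bisimulation)

lemma star_invariant:
  assumes "t * u = t * u * t" "t * t = t"
  shows "t * star u = t * star u * t"
  using star_bisimulation[of t u "t * u"] assms by (simp add: mult.assoc)

section \<open>Products with tests, and Boolean complements\<close>

lemma mult_left_eq: "a * b = c \<Longrightarrow> a * (b * z) = c * z"
  by (simp add: mult.assoc[symmetric])

text \<open>In the applications \<open>p\<close> is a label test: a step that cannot end in
  \<open>p\<close> cannot be followed by one guarded by \<open>p\<close>.\<close>

lemma mult_eq_zero_via: "a * p = 0 \<Longrightarrow> p * b = b \<Longrightarrow> a * b = 0"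
  by (metis mult.assoc mult_zero_left)

lemma mult_eq_via:
  assumes "a * p = a" "p * x = p * y"
  shows "a * x = a * y"
proof -
  have "a * x = a * (p * x)" using assms(1) by (simp add: mult_left_eq)
  also have "\<dots> = a * y" using assms by (simp add: mult_left_eq)
  finally show ?thesis .
qed

lemma mult_invariant: "a * p = a \<Longrightarrow> p * x = p * x * p \<Longrightarrow> a * x * p = a * x"
  using mult_eq_via[of a p "x * p" x] by (simp add: mult.assoc)

lemma mult_test_absorb:
  assumes "test b" "x * neg b = 0"
  shows "x * b = x"
proof -
  have "x = x * (b + neg b)" using assms(1) by (simp add: test_add_neg)
  thus ?thesis using assms(2) by (simp add: distrib_left)
qed

lemma mult_neg_id:
  assumes "test b" "x * b = 0"
  shows "x * neg b = x"
proof -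
  have "x = x * (b + neg b)" using assms(1) by (simp add: test_add_neg)
  thus ?thesis using assms(2) by (simp add: distrib_left)
qed

lemma neg_mult_id:
  assumes "test b" "b * x = 0"
  shows "neg b * x = x"
proof -
  have "x = (b + neg b) * x" using assms(1) by (simp add: test_add_neg)
  thus ?thesis using assms(2) by (simp add: distrib_right)
qed

lemma test_idem:
  assumes "test a"
  shows "a * a = a"
  by (metis add_0_right assms distrib_left mult_1_right test_add_neg test_mult_neg)

lemma neg_unique:
  assumes "test a" "test b" "a * b = 0" "a + b = 1"
  shows "neg a = b"
  by (metis add_0_left assms distrib_left distrib_right mult_1_left mult_1_right test_commute
      test_add_neg test_mult_neg test_neg)

lemma neg_add:
  assumes "test a" "test b"
  shows "neg (a + b) = neg a * neg b"
proof (rule neg_unique)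
  show "test (a + b)" "test (neg a * neg b)"
    using assms by (auto intro: test_add test_mult test_neg)
  have "a * (neg a * neg b) = 0"
    by (metis assms(1) mult.assoc mult_zero_left test_mult_neg)
  moreover have "b * (neg a * neg b) = 0"
    by (metis assms mult.assoc mult_zero_left test_commute test_mult_neg test_neg)
  ultimately show "(a + b) * (neg a * neg b) = 0"
    by (simp add: distrib_right)
  have "a + b + neg a = 1" "a + b + neg b = 1"
    using assms by (metis add_aci test_add_neg)+
  thus "a + b + neg a * neg b = 1"
    using assms by (simp add: test_add_distrib test_add test_neg)
qed

end

section \<open>The term model\<close>

text \<open>A KAT whose elements are families of terms, indexed by the sets of hypotheses, up to
  pointwise derivability.  The index has to be part of the type because a type cannot depend on
  the fixed set of hypotheses.\<close>

definition fam_eq ::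
    "((('t, 'a) kat \<times> ('t, 'a) kat) set \<Rightarrow> ('t, 'a) kat) \<Rightarrow>
     ((('t, 'a) kat \<times> ('t, 'a) kat) set \<Rightarrow> ('t, 'a) kat) \<Rightarrow> bool" where
  "fam_eq u v \<longleftrightarrow> (\<forall>H. H \<turnstile> u H \<approx> v H)"

quotient_type ('t, 'a) kat_fam =
  "(('t, 'a) kat \<times> ('t, 'a) kat) set \<Rightarrow> ('t, 'a) kat" / fam_eq
  by (intro equivpI reflpI sympI transpI)
    (auto simp: fam_eq_def intro: kat_derivable.refl kat_derivable.sym kat_derivable.trans)

instantiation kat_fam :: (type, type) kat_algebra
begin

lift_definition zero_kat_fam :: "('a, 'b) kat_fam" is "\<lambda>_. KZero" .
lift_definition one_kat_fam :: "('a, 'b) kat_fam" is "\<lambda>_. KOne" .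
lift_definition plus_kat_fam :: "('a, 'b) kat_fam \<Rightarrow> ('a, 'b) kat_fam \<Rightarrow> ('a, 'b) kat_fam"
  is "\<lambda>u v H. KPlus (u H) (v H)" by (auto simp: fam_eq_def intro: cong_plus)
lift_definition times_kat_fam :: "('a, 'b) kat_fam \<Rightarrow> ('a, 'b) kat_fam \<Rightarrow> ('a, 'b) kat_fam"
  is "\<lambda>u v H. KSeq (u H) (v H)" by (auto simp: fam_eq_def intro: cong_seq)
lift_definition star_kat_fam :: "('a, 'b) kat_fam \<Rightarrow> ('a, 'b) kat_fam"
  is "\<lambda>u H. KStar (u H)" by (auto simp: fam_eq_def intro: cong_star)
lift_definition neg_kat_fam :: "('a, 'b) kat_fam \<Rightarrow> ('a, 'b) kat_fam"
  is "\<lambda>u H. KNot (u H)" by (auto simp: fam_eq_def intro: cong_not)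
text \<open>Derivability may equate a test with an expression that is not one syntactically, so the
  predicate asks only for some representative made of tests.\<close>

lift_definition test_kat_fam :: "('a, 'b) kat_fam \<Rightarrow> bool"
  is "\<lambda>u. \<exists>v. fam_eq u v \<and> (\<forall>H. is_test (v H))"
  using kat_fam_equivp unfolding equivp_def by metis

lemma test_kat_fam_iff:
  "test x \<longleftrightarrow> (\<exists>v. x = abs_kat_fam v \<and> (\<forall>H. is_test (v H)))"
  for x :: "('a, 'b) kat_fam"
  by (induction x rule: kat_fam.abs_induct) (auto simp: test_kat_fam.abs_eq kat_fam.abs_eq_iff)

lemmas kat_fam_abs_eqs = zero_kat_fam.abs_eq one_kat_fam.abs_eq plus_kat_fam.abs_eq
  times_kat_fam.abs_eq star_kat_fam.abs_eq neg_kat_fam.abs_eq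

instance
proof
  fix x y z :: "('a, 'b) kat_fam"
  show "x + y + z = x + (y + z)" by transfer (simp add: fam_eq_def plus_assoc)
  show "x + y = y + x" by transfer (simp add: fam_eq_def plus_comm)
  show "0 + x = x" by transfer (meson fam_eq_def plus_comm plus_zero kat_derivable.trans)
  show "x * y * z = x * (y * z)" by transfer (simp add: fam_eq_def seq_assoc)
  show "0 * x = 0" by transfer (simp add: fam_eq_def zero_seq)
  show "x * 0 = 0" by transfer (simp add: fam_eq_def seq_zero)
  show "(x + y) * z = x * z + y * z" by transfer (simp add: fam_eq_def distrib_right)
  show "x * (y + z) = x * y + x * z" by transfer (simp add: fam_eq_def distrib_left)
  show "1 * x = x" by transfer (simp add: fam_eq_def one_seq)
  show "x * 1 = x" by transfer (simp add: fam_eq_def seq_one)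
  show "x + x = x" by transfer (simp add: fam_eq_def plus_idem)
  show "1 + x * star x = star x" by transfer (simp add: fam_eq_def star_unfold_left)
  show "1 + star x * x = star x" by transfer (simp add: fam_eq_def star_unfold_right)
  show "y + x * z + z = z \<Longrightarrow> star x * y + z = z"
    by transfer (simp add: fam_eq_def star_induct_left)
  show "y + z * x + z = z \<Longrightarrow> y * star x + z = z"
    by transfer (simp add: fam_eq_def star_induct_right)
  show "test (0 :: ('a, 'b) kat_fam)" "test (1 :: ('a, 'b) kat_fam)"
    unfolding test_kat_fam_iff kat_fam_abs_eqs by (auto intro: is_test.intros)
next
  fix a b c :: "('a, 'b) kat_fam"
  show "test a \<Longrightarrow> test (neg a)"
    unfolding test_kat_fam_iff by (force simp: kat_fam_abs_eqs intro: is_test.intros)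
  show "test a \<Longrightarrow> test b \<Longrightarrow> test (a + b)"
    unfolding test_kat_fam_iff by (force simp: kat_fam_abs_eqs intro: is_test.intros)
  show "test a \<Longrightarrow> test b \<Longrightarrow> test (a * b)"
    unfolding test_kat_fam_iff by (force simp: kat_fam_abs_eqs intro: is_test.intros)
  show "test a \<Longrightarrow> test b \<Longrightarrow> a * b = b * a"
    by (auto simp: test_kat_fam_iff kat_fam_abs_eqs kat_fam.abs_eq_iff fam_eq_def test_seq_comm)
  show "test a \<Longrightarrow> test b \<Longrightarrow> test c \<Longrightarrow> a + b * c = (a + b) * (a + c)"
    by (auto simp: test_kat_fam_iff kat_fam_abs_eqs kat_fam.abs_eq_iff fam_eq_def test_distrib)
  show "test a \<Longrightarrow> a * neg a = 0"
    by (auto simp: test_kat_fam_iff kat_fam_abs_eqs kat_fam.abs_eq_iff fam_eq_def test_compl_seq)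
  show "test a \<Longrightarrow> a + neg a = 1"
    by (auto simp: test_kat_fam_iff kat_fam_abs_eqs kat_fam.abs_eq_iff fam_eq_def test_compl_plus)
qed

end

primrec keval :: "('t \<Rightarrow> 'k) \<Rightarrow> ('a \<Rightarrow> 'k) \<Rightarrow> ('t, 'a) kat \<Rightarrow> 'k :: kat_algebra" where
  "keval T A (KTest p) = T p"
| "keval T A (KAct a) = A a"
| "keval T A KZero = 0"
| "keval T A KOne = 1"
| "keval T A (KPlus x y) = keval T A x + keval T A y"
| "keval T A (KSeq x y) = keval T A x * keval T A y"
| "keval T A (KStar x) = star (keval T A x)"
| "keval T A (KNot x) = neg (keval T A x)"

section \<open>Guards and labels\<close>

lemma bval_disj: "bs \<noteq> [] \<Longrightarrow> bval I J (disj bs) s \<longleftrightarrow> (\<exists>b \<in> set bs. bval I J b s)"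
  by (induction bs rule: disj.induct) auto

lemma bval_enab: "gcs \<noteq> [] \<Longrightarrow> bval I J (enab gcs) s \<longleftrightarrow> (\<exists>(e, d) \<in> set gcs. bval I J e s)"
  by (force simp: enab_def bval_disj)

lemma bval_at [simp]: "bval I J (at pc n) s \<longleftrightarrow> s pc = n"
  by (simp add: at_def)

lemma lab_in_labs: "lab c \<in> labs c"
  by (induction c) (auto simp: labs_def)

lemma distinct_concat_disjoint:
  assumes "distinct (concat xss)" "i < length xss" "j < length xss" "i \<noteq> j"
  shows "set (xss ! i) \<inter> set (xss ! j) = {}"
proof -
  have "set (xss ! i) \<inter> set (xss ! j) = {}"
    if "i < j" "j < length xss" "distinct (concat xss)" for i j
    using that
  proof (induction xss arbitrary: i j)
    case (Cons xs xss)
    have "set xs \<inter> set (xss ! m) = {}" if "m < length xss" for m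
      using Cons.prems(3) nth_mem[OF that] by auto
    with Cons show ?case by (cases i; cases j) simp_all
  qed simp
  with assms show ?thesis by (cases i j rule: linorder_cases) (auto simp: Int_commute)
qed

lemma distinct_concat_nth:
  "distinct (concat xss) \<Longrightarrow> i < length xss \<Longrightarrow> distinct (xss ! i)"
  by (simp add: distinct_concat_iff)

text \<open>The unions run over positions, not over the set of branches, to match the indexed
  families in \<open>implements_if\<close> and \<open>implements_do\<close>.\<close>

lemma labs_compound:
  "labs (If n gcs) = insert n (\<Union>i<length gcs. labs (snd (gcs ! i)))"
  "labs (Do n gcs) = insert n (\<Union>i<length gcs. labs (snd (gcs ! i)))"
proof -
  have "set gcs = (!) gcs ` {..<length gcs}" by (auto simp: set_conv_nth)
  hence "(\<Union>(e, d)\<in>set gcs. labs d) = (\<Union>i<length gcs. labs (snd (gcs ! i)))"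
    by (simp add: case_prod_unfold image_image)
  thus "labs (If n gcs) = insert n (\<Union>i<length gcs. labs (snd (gcs ! i)))"
    "labs (Do n gcs) = insert n (\<Union>i<length gcs. labs (snd (gcs ! i)))"
    by (auto simp: labs_def case_prod_unfold)
qed

lemma labs_branches_disjoint:
  assumes "distinct (n # concat (map (\<lambda>(e, d). label_list d) gcs))" "i < length gcs"
  shows "distinct (label_list (snd (gcs ! i)))" "n \<notin> labs (snd (gcs ! i))"
    "j < length gcs \<Longrightarrow> i \<noteq> j \<Longrightarrow> labs (snd (gcs ! i)) \<inter> labs (snd (gcs ! j)) = {}"
  using assms nth_mem[OF assms(2)] distinct_concat_nth[of "map (\<lambda>(e, d). label_list d) gcs" i]
    distinct_concat_disjoint[of "map (\<lambda>(e, d). label_list d) gcs" i j]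
  by (auto simp: labs_def case_prod_unfold)

section \<open>Programs in a KAT model\<close>

locale kat_model =
  fixes I :: "'f \<Rightarrow> int list \<Rightarrow> int"
    and J :: "'r \<Rightarrow> int list \<Rightarrow> bool"
    and T :: "('v, 'f, 'r) prim \<Rightarrow> 'k :: kat_algebra"
    and A :: "'v \<times> ('v, 'f) iexp \<Rightarrow> 'k"
    and pc :: 'v
  assumes test_T: "test (T p)"
    and Hyp_sound: "(x, y) \<in> Hyp I J \<Longrightarrow> keval T A x = keval T A y"
begin

abbreviation B :: "('v, 'f, 'r) prim bexp \<Rightarrow> 'k" where
  "B e \<equiv> keval T A (kat_bexp e)"

abbreviation C :: "('v, 'f, 'r) com \<Rightarrow> 'k" where
  "C c \<equiv> keval T A (kat_com c)"

definition body :: "('v, 'f, 'r) gcs \<Rightarrow> 'k" where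
  "body gcs = (\<Sum>(e, d) \<leftarrow> gcs. B e * C d)"

definition jump :: "int \<Rightarrow> 'k" where
  "jump n = A (pc, Const n)"

text \<open>The sum over an infinite set defaults to 0, which is why finiteness of label sets is
  carried along.\<close>

definition pc_in :: "int set \<Rightarrow> 'k" where
  "pc_in S = (\<Sum>n \<in> S. B (at pc n))"

section \<open>Semantic reasoning about tests, and the algebra of label tests\<close>

lemma test_B: "test (B e)"
  by (induction e) (auto intro: test_T test_add test_mult test_neg)

lemma B_false: "(\<And>s. \<not> bval I J e s) \<Longrightarrow> B e = 0"
  using Hyp_sound[of "kat_bexp e" KZero] by (auto simp: Hyp_def)

lemma B_true: "(\<And>s. bval I J e s) \<Longrightarrow> B e = 1"
  using B_false[of "BNot e"] test_add_neg[OF test_B, of e] by simp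

text \<open>Entailment in all stores becomes an inequality of tests: \<open>Hyp\<close> kills the
  conjunction of \<open>e\<close> with the negation of \<open>e'\<close>.\<close>

lemma B_absorb:
  assumes "\<And>s. bval I J e s \<Longrightarrow> bval I J e' s"
  shows "B e * B e' = B e"
proof -
  have "B (BAnd e (BNot e')) = 0" using assms by (intro B_false) auto
  hence "B e * neg (B e') = 0" by simp
  thus ?thesis by (intro mult_test_absorb test_B)
qed

lemma B_cong:
  assumes "\<And>s. bval I J e s \<longleftrightarrow> bval I J e' s"
  shows "B e = B e'"
proof -
  have "B e * B e' = B e" by (rule B_absorb) (simp add: assms)
  moreover have "B e' * B e = B e'" by (rule B_absorb) (simp add: assms)
  ultimately show ?thesis using test_commute[OF test_B[of e] test_B[of e']] by simp
qed

lemma at_mult_at: "B (at pc m) * B (at pc n) = (if m = n then B (at pc m) else 0)"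
  using B_absorb[of "at pc m" "at pc m"] B_false[of "BAnd (at pc m) (at pc n)"] by auto

lemma pc_in_empty [simp]: "pc_in {} = 0"
  by (simp add: pc_in_def)

lemma pc_in_singleton: "pc_in {n} = B (at pc n)"
  by (simp add: pc_in_def)

lemma test_pc_in: "finite S \<Longrightarrow> test (pc_in S)"
  unfolding pc_in_def by (induction S rule: finite_induct) (simp_all add: test_zero test_add test_B)

text \<open>Different labels exclude each other, so only the diagonal of the double sum
  survives.\<close>

lemma pc_in_Int:
  assumes "finite S" "finite S'"
  shows "pc_in S * pc_in S' = pc_in (S \<inter> S')"
proof -
  have "pc_in S * pc_in S' = (\<Sum>m\<in>S. \<Sum>n\<in>S'. if m = n then B (at pc m) else 0)"
    unfolding pc_in_def sum_product at_mult_at ..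
  also have "\<dots> = (\<Sum>m\<in>S. if m \<in> S' then B (at pc m) else 0)"
    using assms(2) by (simp only: sum.delta')
  also have "\<dots> = pc_in (S \<inter> S')"
    unfolding pc_in_def using assms(1) by (simp only: sum.inter_restrict)
  finally show ?thesis .
qed

text \<open>Idempotence of addition covers the case that \<open>n\<close> is already in
  \<open>S\<close>.\<close>

lemma pc_in_insert:
  assumes "finite S"
  shows "pc_in (insert n S) = B (at pc n) + pc_in S"
proof (cases "n \<in> S")
  case True
  hence "pc_in S = B (at pc n) + pc_in (S - {n})"
    using assms unfolding pc_in_def by (simp add: sum.remove)
  with True show ?thesis by (metis add_idem_left insert_absorb)
next
  case False
  with assms show ?thesis by (simp add: pc_in_def)
qed

lemma pc_in_Un: "finite S \<Longrightarrow> finite S' \<Longrightarrow> pc_in (S \<union> S') = pc_in S + pc_in S'"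
  by (induction S rule: finite_induct) (simp_all add: pc_in_insert add.assoc)

text \<open>The unqualified \<open>distrib_left\<close> and \<open>distrib_right\<close> are rules of \<open>kat_derivable\<close> here, which
  hide the facts about semirings.\<close>

lemma pc_in_neg:
  assumes "finite S" "finite S'"
  shows "pc_in S * neg (pc_in S') = pc_in (S - S')"
proof -
  \<comment> \<open>Split \<open>S\<close> along \<open>S'\<close>: the negated test annihilates the
    part inside and fixes the part outside.\<close>
  have "pc_in S = pc_in (S - S') + pc_in (S \<inter> S')"
    using assms pc_in_Un[of "S - S'" "S \<inter> S'"] by (simp add: Un_Diff_Int)
  moreover have "pc_in (S \<inter> S') * neg (pc_in S') = 0"
    using assms by (simp add: pc_in_Int[symmetric] mult.assoc test_mult_neg test_pc_in)
  moreover have "pc_in (S - S') * neg (pc_in S') = pc_in (S - S')"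
    using assms by (intro mult_neg_id) (simp_all add: test_pc_in pc_in_Int Int_commute)
  ultimately show ?thesis by (simp add: semiring_class.distrib_right)
qed

lemma neg_pc_in_Un:
  assumes "finite S" "finite S'"
  shows "neg (pc_in (S \<union> S')) = neg (pc_in S) * neg (pc_in S')"
  using assms by (simp add: pc_in_Un neg_add test_pc_in)

section \<open>Assignments and jumps\<close>

lemma B_assign:
  assumes "\<And>s. bval I J e0 s \<Longrightarrow> bval I J e1 (s(x := ival I e s))"
  shows "B e0 * A (x, e) * neg (B e1) = 0"
proof -
  have "(KSeq (KSeq (kat_bexp e0) (KAct (x, e))) (KNot (kat_bexp e1)), KZero) \<in> Hyp I J"
    unfolding Hyp_def using assms by blast
  from Hyp_sound[OF this] show ?thesis by simp
qed

lemma jump_at: "jump n * pc_in {n} = jump n"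
proof -
  \<comment> \<open>A tautology as precondition, since the language has no constant for
    true.\<close>
  let ?t = "BOr (at pc n) (BNot (at pc n))"
  have "B ?t = 1" by (rule B_true) simp
  moreover have "B ?t * jump n * neg (B (at pc n)) = 0"
    unfolding jump_def by (rule B_assign) simp
  ultimately show ?thesis
    by (simp add: pc_in_singleton mult_test_absorb test_B)
qed

text \<open>Inserting the test \<open>pc_in {n}\<close> that the jump establishes reduces the claim
  to an intersection of label sets.\<close>

lemma jump_pc_in:
  assumes "finite S"
  shows "jump n * pc_in S = (if n \<in> S then jump n else 0)"
proof -
  have "jump n * pc_in S = jump n * (pc_in {n} * pc_in S)"
    by (metis jump_at mult.assoc)
  also have "\<dots> = jump n * pc_in ({n} \<inter> S)" using assms by (simp add: pc_in_Int)
  finally show ?thesis by (simp add: jump_at)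
qed

text \<open>\<open>g\<close> is the loop body of a program fragment with label set \<open>L\<close>, entry \<open>l\<close> and exit \<open>f\<close>,
  and \<open>r\<close> is the structured code of the fragment.\<close>

definition implements :: "'k \<Rightarrow> int set \<Rightarrow> int \<Rightarrow> int \<Rightarrow> 'k \<Rightarrow> bool" where
  "implements g L l f r \<longleftrightarrow> finite L \<and> l \<in> L \<and> f \<notin> L \<and> pc_in L * g = g \<and>
     g * pc_in (insert f L) = g \<and> jump l * star g * neg (pc_in L) = r * jump f"

lemmas jump_pc_in_left = jump_pc_in[THEN mult_left_eq]

lemma jump_mult_neg:
  assumes "finite S" "n \<in> S"
  shows "jump n * neg (pc_in S) = 0"
proof -
  have "jump n * neg (pc_in S) = jump n * (pc_in S * neg (pc_in S))"
    using assms by (simp add: jump_pc_in_left)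
  thus ?thesis using assms by (simp add: test_mult_neg test_pc_in)
qed

lemma jump_mult_neg':
  assumes "finite S" "n \<notin> S"
  shows "jump n * neg (pc_in S) = jump n"
proof -
  have "jump n * neg (pc_in S) = jump n * (pc_in {n} * neg (pc_in S))"
    by (simp add: jump_pc_in_left)
  moreover have "{n} - S = {n}" using assms(2) by blast
  ultimately show ?thesis using assms(1) by (simp add: pc_in_neg jump_at)
qed

section \<open>Enlarging label tests; atomic and sequential fragments\<close>

lemma pc_in_superset:
  assumes "pc_in S * x = x" "S \<subseteq> S'" "finite S'"
  shows "pc_in S' * x = x"
proof -
  have "pc_in S' * x = pc_in S' * pc_in S * x" using assms(1) by (simp add: mult.assoc)
  also have "\<dots> = x" using assms by (simp add: pc_in_Int finite_subset Int_absorb1)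
  finally show ?thesis .
qed

lemma superset_pc_in:
  assumes "x * pc_in S = x" "S \<subseteq> S'" "finite S'"
  shows "x * pc_in S' = x"
proof -
  have "x * pc_in S' = x * (pc_in S * pc_in S')" using assms(1) by (simp add: mult_left_eq)
  also have "\<dots> = x" using assms by (simp add: pc_in_Int finite_subset Int_absorb2)
  finally show ?thesis .
qed

text \<open>The body leaves \<open>n\<close> for \<open>f\<close> and cannot run twice, so its star
  is \<open>1 + g\<close> for the body \<open>g\<close>; the exit test removes the summand 1, where
  \<open>pc\<close> is still \<open>n\<close>.\<close>

lemma implements_atom:
  assumes "n \<noteq> f"
  shows "implements (B (at pc n) * (a * jump f)) {n} n f (jump n * a)"
proof -
  let ?g = "pc_in {n} * (a * jump f)"
  have L: "pc_in {n} * ?g = ?g" by (simp add: mult.assoc[symmetric] pc_in_Int)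
  have R: "?g * pc_in {f, n} = ?g" by (simp add: mult.assoc jump_pc_in)
  have "?g * pc_in {n} = 0" using assms by (simp add: mult.assoc jump_pc_in)
  hence "?g * ?g = 0" using L by (rule mult_eq_zero_via)
  hence "jump n * star ?g * neg (pc_in {n})
      = jump n * neg (pc_in {n}) + jump n * ?g * neg (pc_in {n})"
    by (simp add: star_nilpotent semiring_class.distrib_left semiring_class.distrib_right)
  also have "\<dots> = jump n * a * jump f"
    using assms by (simp add: mult.assoc jump_mult_neg jump_mult_neg' jump_pc_in_left)
  finally show ?thesis using L R assms
    by (simp add: implements_def pc_in_singleton)
qed

text \<open>Control never returns from the second fragment to the first, so the star of the sum
  splits into a product, and each factor receives its own exit test.\<close>

lemma implements_seq:
  assumes "implements g L l m r" "implements g' L' m f r'" "L \<inter> L' = {}" "f \<notin> L"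
  shows "implements (g + g') (L \<union> L') l f (r * r')"
proof -
  let ?p = "pc_in L" and ?p' = "pc_in L'"
  have fin: "finite L" "finite L'"
    and l: "l \<in> L" "f \<notin> L'" "m \<in> L'"
    and g: "?p * g = g" "g * pc_in (insert m L) = g" "jump l * star g * neg ?p = r * jump m"
    and g': "?p' * g' = g'" "g' * pc_in (insert f L') = g'"
      "jump m * star g' * neg ?p' = r' * jump f"
    using assms by (auto simp: implements_def)
  have pp': "?p * ?p' = 0" using fin assms(3) by (simp add: pc_in_Int)
  \<comment> \<open>The range of \<open>g'\<close> is \<open>insert f L'\<close>, which avoids
    \<open>L\<close>.\<close>
  have g'p: "g' * ?p = 0"
    using fin assms(3,4) by (subst g'(2)[symmetric]) (simp add: mult.assoc pc_in_Int Int_commute)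
  have "g' * g = 0" using g'p g(1) by (rule mult_eq_zero_via)
  hence star: "star (g + g') = star g * star g'" by (rule star_add_annihilate)
  have neg: "neg (pc_in (L \<union> L')) = neg ?p * neg ?p'" using fin by (rule neg_pc_in_Un)
  have "?p * g' = 0" using pp' g'(1) by (rule mult_eq_zero_via)
  hence "neg ?p * g' = g'" using fin by (intro neg_mult_id test_pc_in)
  moreover have "g' * neg ?p = g'" using fin g'p by (intro mult_neg_id test_pc_in)
  \<comment> \<open>As \<open>neg ?p\<close> is an identity on both sides of \<open>g'\<close>, the
    first exit test moves in front of \<open>star g'\<close>.\<close>
  ultimately have comm: "star g' * neg ?p = neg ?p * star g'"
    by (intro star_bisimulation[symmetric]) simp
  have "jump l * star (g + g') * neg (pc_in (L \<union> L'))
      = jump l * star g * (star g' * neg ?p) * neg ?p'"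
    by (simp add: star neg mult.assoc)
  also have "\<dots> = jump l * star g * neg ?p * (star g' * neg ?p')"
    unfolding comm by (simp add: mult.assoc)
  also have "\<dots> = r * r' * jump f"
    using g(3) g'(3) by (simp add: mult.assoc)
  finally have "jump l * star (g + g') * neg (pc_in (L \<union> L')) = r * r' * jump f" .
  moreover have "pc_in (L \<union> L') * g = g" "pc_in (L \<union> L') * g' = g'"
    using fin g(1) g'(1) by (auto elim: pc_in_superset)
  moreover have "g * pc_in (insert f (L \<union> L')) = g" "g' * pc_in (insert f (L \<union> L')) = g'"
    using fin l g(2) g'(2) by (auto elim!: superset_pc_in)
  ultimately show ?thesis using fin l assms(4)
    by (simp add: implements_def semiring_class.distrib_left semiring_class.distrib_right)
qed

text \<open>The branches \<open>g i\<close> of a fragment have disjoint label sets and a common exit \<open>t\<close>, so entering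
  at \<open>l i\<close> runs only the branch \<open>i\<close>.\<close>

context
  fixes k :: nat and g r :: "nat \<Rightarrow> 'k" and L :: "nat \<Rightarrow> int set" and l :: "nat \<Rightarrow> int" and t :: int
  assumes impl: "\<And>i. i < k \<Longrightarrow> implements (g i) (L i) (l i) t (r i)"
    and disjoint: "\<And>i j. i < k \<Longrightarrow> j < k \<Longrightarrow> i \<noteq> j \<Longrightarrow> L i \<inter> L j = {}"
begin

lemma branches_finite: "i < k \<Longrightarrow> finite (L i)" "finite (\<Union>i<k. L i)"
  using impl by (auto simp: implements_def)

lemma branches_guard: "pc_in (\<Union>i<k. L i) * (\<Sum>i<k. g i) = (\<Sum>i<k. g i)"
proof -
  have "pc_in (\<Union>i<k. L i) * g i = g i" if "i < k" for i
    by (rule pc_in_superset[of "L i"]) (use that impl branches_finite in \<open>auto simp: implements_def\<close>)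
  thus ?thesis by (simp add: sum_distrib_left)
qed

lemma branches_range:
  "(\<Sum>i<k. g i) * pc_in (insert t (\<Union>i<k. L i)) = (\<Sum>i<k. g i)"
proof -
  have "g i * pc_in (insert t (\<Union>i<k. L i)) = g i" if "i < k" for i
    by (rule superset_pc_in[of _ "insert t (L i)"])
      (use that impl branches_finite in \<open>auto simp: implements_def\<close>)
  thus ?thesis by (simp add: sum_distrib_right)
qed

text \<open>The other branches are guarded by label sets that avoid both \<open>L i\<close> and
  \<open>t\<close>, so the test annihilates them.\<close>

lemma branches_restrict:
  assumes "i < k"
  shows "pc_in (insert t (L i)) * (\<Sum>j<k. g j) = g i"
proof -
  have "pc_in (insert t (L i)) * g j = (if j = i then g i else 0)" if "j < k" for j
  proof (cases "j = i")
    case True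
    with assms impl pc_in_superset[of "L i" "g i" "insert t (L i)"] show ?thesis
      by (auto simp: implements_def)
  next
    case False
    hence "insert t (L i) \<inter> L j = {}"
      using disjoint[of i j] impl[of j] assms that by (auto simp: implements_def)
    hence "pc_in (insert t (L i)) * pc_in (L j) = 0"
      using branches_finite assms that by (simp add: pc_in_Int)
    moreover have "pc_in (L j) * g j = g j" using impl[of j] that by (simp add: implements_def)
    ultimately show ?thesis using False by (simp add: mult_eq_zero_via)
  qed
  thus ?thesis using assms by (simp add: sum_distrib_left)
qed

text \<open>The test for \<open>insert t (L i)\<close> is an invariant of \<open>g i\<close>, and
  below it the whole sum agrees with \<open>g i\<close>; so \<open>star_restrict\<close> exchanges
  the two stars.\<close>

lemma jump_branches:
  assumes "i < k"
  shows "jump (l i) * star (\<Sum>j<k. g j) * pc_in (insert t (L i)) = jump (l i) * star (\<Sum>j<k. g j)"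
    and "jump (l i) * star (\<Sum>j<k. g j) * B (at pc t) = r i * jump t"
proof -
  let ?S = "\<Sum>j<k. g j" and ?p = "pc_in (insert t (L i))"
  have fin: "finite (L i)" and l: "l i \<in> L i" "t \<notin> L i"
    and g: "g i * ?p = g i" "jump (l i) * star (g i) * neg (pc_in (L i)) = r i * jump t"
    using impl[OF assms] by (auto simp: implements_def)
  have pg: "?p * g i = g i"
    using impl[OF assms] pc_in_superset[of "L i" "g i" "insert t (L i)"]
    by (auto simp: implements_def)
  have pS: "?p * ?S = g i" using assms by (rule branches_restrict)
  have jp: "jump (l i) * ?p = jump (l i)" using fin l by (simp add: jump_pc_in)
  have "?p * star ?S = ?p * star (g i)"
    by (rule star_restrict) (simp_all add: pg pS g)
  with jp have j: "jump (l i) * star ?S = jump (l i) * star (g i)"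
    by (rule mult_eq_via)
  have "?p * star (g i) = ?p * star (g i) * ?p"
    using fin by (intro star_invariant) (simp_all add: pg g test_idem test_pc_in)
  with jp have p: "jump (l i) * star (g i) * ?p = jump (l i) * star (g i)"
    by (rule mult_invariant)
  show "jump (l i) * star ?S * ?p = jump (l i) * star ?S" by (simp add: j p)
  \<comment> \<open>Within the invariant, having left \<open>L i\<close> means being at
    \<open>t\<close>.\<close>
  have "B (at pc t) = ?p * neg (pc_in (L i))"
    using fin l by (simp add: pc_in_neg pc_in_singleton insert_Diff_if)
  hence "jump (l i) * star ?S * B (at pc t)
      = jump (l i) * star (g i) * ?p * neg (pc_in (L i))"
    by (simp add: j mult.assoc)
  thus "jump (l i) * star ?S * B (at pc t) = r i * jump t" by (simp add: p g)
qed

text \<open>The dispatch \<open>b\<close> from \<open>n\<close> is never re-entered, so the star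
  becomes \<open>(1 + b) * star S\<close>. The exit test removes the summand without dispatch, and
  after the jump to \<open>l i\<close> only branch \<open>i\<close> runs.\<close>

lemma implements_if:
  assumes "n \<notin> (\<Union>i<k. L i)" "n \<noteq> t" "t \<notin> (\<Union>i<k. L i)"
  shows "implements (B (at pc n) * (\<Sum>i<k. e i * jump (l i)) + (\<Sum>i<k. g i))
    (insert n (\<Union>i<k. L i)) n t (jump n * (\<Sum>i<k. e i * r i))"
proof -
  define U where "U = (\<Union>i<k. L i)"
  define S where "S = (\<Sum>i<k. g i)"
  define X where "X = (\<Sum>i<k. e i * jump (l i))"
  define b where "b = pc_in {n} * X"
  have fin: "finite U" and U: "n \<notin> U" "t \<notin> U"
    using assms branches_finite by (auto simp: U_def)
  have SU: "pc_in U * S = S" "S * pc_in (insert t U) = S"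
    unfolding U_def S_def by (rule branches_guard branches_range)+
  have lU: "i < k \<Longrightarrow> l i \<in> U" for i using impl[of i] by (auto simp: U_def implements_def)
  have XU: "X * pc_in U = X"
    using fin lU by (simp add: X_def sum_distrib_right mult.assoc jump_pc_in)
  have "pc_in (insert t U) * pc_in {n} = 0" "pc_in U * pc_in {n} = 0"
    using fin U assms by (simp_all add: pc_in_Int)
  hence Sn: "S * pc_in {n} = 0" and Xn: "X * pc_in {n} = 0"
    using SU(2) XU by (metis mult.assoc mult_zero_right)+
  have nb: "pc_in {n} * b = b" by (simp add: b_def mult.assoc[symmetric] pc_in_Int)
  have "S * b = 0" using Sn nb by (rule mult_eq_zero_via)
  moreover have "b * b = 0"
    using Xn by (intro mult_eq_zero_via[OF _ nb]) (simp add: b_def mult.assoc)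
  ultimately have star: "star (b + S) = star S + b * star S"
    by (simp add: star_add_annihilate star_nilpotent semiring_class.distrib_right)
  \<comment> \<open>No branch step can start at \<open>n\<close>.\<close>
  have "jump n * S = 0"
    using fin U by (intro mult_eq_zero_via[OF _ SU(1)]) (simp add: jump_pc_in)
  hence jS: "jump n * star S = jump n" by (rule mult_star_annihilate)
  have exit: "jump (l i) * star S * neg (pc_in (insert n U)) = r i * jump t" if i: "i < k" for i
  proof -
    \<comment> \<open>Of the labels that branch \<open>i\<close> can reach, only \<open>t\<close>
      lies outside the fragment.\<close>
    have "insert t (L i) - insert n U = {t}"
      using i U assms(2) by (auto simp: U_def)
    hence "pc_in (insert t (L i)) * neg (pc_in (insert n U)) = B (at pc t)"
      using fin branches_finite i by (simp add: pc_in_neg pc_in_singleton)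
    with jump_branches[OF i, folded S_def] show ?thesis
      by (metis mult_left_eq)
  qed
  have "jump n * star (b + S) * neg (pc_in (insert n U))
      = jump n * b * (star S * neg (pc_in (insert n U)))"
    using fin by (simp add: star semiring_class.distrib_left semiring_class.distrib_right
        mult.assoc[symmetric] jS jump_mult_neg)
  also have "\<dots> = jump n * (X * (star S * neg (pc_in (insert n U))))"
    by (simp add: b_def mult.assoc jump_pc_in_left)
  also have "X * (star S * neg (pc_in (insert n U))) = (\<Sum>i<k. e i * (r i * jump t))"
    unfolding X_def sum_distrib_right
    by (rule sum.cong[OF HOL.refl]) (simp add: mult.assoc exit[unfolded mult.assoc])
  also have "jump n * \<dots> = jump n * (\<Sum>i<k. e i * r i) * jump t"
    by (simp add: sum_distrib_right mult.assoc)
  finally have "jump n * star (b + S) * neg (pc_in (insert n U))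
    = jump n * (\<Sum>i<k. e i * r i) * jump t" .
  moreover have "pc_in (insert n U) * b = b" "pc_in (insert n U) * S = S"
    using fin nb SU(1) by (auto elim: pc_in_superset)
  moreover have "b * pc_in U = b" by (simp add: b_def mult.assoc XU)
  hence "b * pc_in (insert t (insert n U)) = b" "S * pc_in (insert t (insert n U)) = S"
    using fin SU(2) by (auto elim!: superset_pc_in)
  ultimately show ?thesis
    using fin U assms(2)
    by (simp add: implements_def U_def[symmetric] S_def[symmetric] X_def[symmetric]
        pc_in_singleton[symmetric] b_def[symmetric]
        semiring_class.distrib_left semiring_class.distrib_right)
qed

text \<open>The branches exit to the loop's own label \<open>t\<close>. The exit step
  \<open>F\<close> occurs once, at the end; before it, denesting groups the run into rounds starting
  at \<open>t\<close>, and sliding the test \<open>q\<close> through these rounds turns them into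
  iterations of \<open>Y\<close>.\<close>

lemma implements_do:
  assumes "f \<notin> (\<Union>i<k. L i)" "f \<noteq> t" "t \<notin> (\<Union>i<k. L i)"
  shows "implements
    (B (at pc t) * (\<Sum>i<k. e i * jump (l i)) + (B (at pc t) * (e' * jump f) + (\<Sum>i<k. g i)))
    (insert t (\<Union>i<k. L i)) t f (jump t * (star (\<Sum>i<k. e i * (r i * jump t)) * e'))"
proof -
  define U where "U = (\<Union>i<k. L i)"
  define E where "E = pc_in (insert t U)"
  define S where "S = (\<Sum>i<k. g i)"
  define X where "X = (\<Sum>i<k. e i * jump (l i))"
  define Y where "Y = (\<Sum>i<k. e i * (r i * jump t))"
  define q where "q = pc_in {t}"
  define b where "b = q * X"
  define F where "F = q * (e' * jump f)"
  \<comment> \<open>A dispatch from \<open>t\<close> followed by branch steps; followed by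
    \<open>q\<close>, it is one complete round.\<close>
  define y where "y = b * star S"
  have fin: "finite U" and U: "f \<notin> U" "t \<notin> U"
    using assms branches_finite by (auto simp: U_def)
  have SU: "pc_in U * S = S" and SE: "S * E = S"
    unfolding U_def S_def E_def by (rule branches_guard branches_range)+
  have lU: "i < k \<Longrightarrow> l i \<in> U" for i using impl[of i] by (auto simp: U_def implements_def)
  have bU: "b * pc_in U = b"
    using fin lU by (simp add: b_def X_def sum_distrib_right mult.assoc jump_pc_in)
  have qq: "q * q = q" by (simp add: q_def pc_in_Int)
  have jq: "jump t * q = jump t" by (simp add: q_def jump_at)
  have qb: "q * b = b" and qF: "q * F = F" by (simp_all add: b_def F_def mult_left_eq qq)
  have bE: "b * E = b" unfolding E_def using fin by (auto intro: superset_pc_in[OF bU])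
  have Eb: "E * b = b" and EF: "E * F = F" and ES: "E * S = S"
    unfolding E_def using fin qb qF SU by (auto simp: q_def elim: pc_in_superset)
  have FE: "F * E = 0"
    using fin U assms(2) by (simp add: F_def E_def mult.assoc jump_pc_in)
  have FnE: "F * neg E = F"
    using fin FE by (intro mult_neg_id) (simp_all add: E_def test_pc_in)
  have "E * (b + S) = b + S" by (simp add: semiring_class.distrib_left Eb ES)
  with FE have "F * (b + S) = 0" by (rule mult_eq_zero_via)
  moreover have "F * F = 0" using FE EF by (rule mult_eq_zero_via)
  ultimately have star: "star (b + S + F) = star (b + S) + star (b + S) * F"
    by (simp add: star_add_annihilate star_nilpotent semiring_class.distrib_left)
  \<comment> \<open>Without \<open>F\<close> the run stays within \<open>E\<close>, so the exit test
    rejects it.\<close>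
  have "E * star (b + S) = E * star (b + S) * E"
    using fin by (intro star_invariant)
      (simp_all add: semiring_class.distrib_left semiring_class.distrib_right Eb ES bE SE
        E_def[symmetric] test_idem test_pc_in, simp add: E_def test_idem test_pc_in)
  moreover have jE: "jump t * E = jump t" using fin by (simp add: E_def jump_pc_in)
  ultimately have "jump t * star (b + S) * E = jump t * star (b + S)"
    by (metis mult_invariant)
  moreover have "E * neg E = 0" using fin by (simp add: E_def test_mult_neg test_pc_in)
  hence "jump t * star (b + S) * E * neg E = 0" by (simp add: mult.assoc)
  ultimately have stay: "jump t * star (b + S) * neg E = 0" by simp
  \<comment> \<open>At \<open>t\<close> no branch step can start, so the leading
    \<open>star S\<close> of the denested star disappears.\<close>
  have "jump t * S = 0"
    using fin U by (intro mult_eq_zero_via[OF _ SU]) (simp add: jump_pc_in)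
  hence jS: "jump t * star S = jump t" by (rule mult_star_annihilate)
  have qy: "q * y = y" by (simp add: y_def mult.assoc[symmetric] qb)
  have Yq: "Y * q = Y" by (simp add: Y_def sum_distrib_right mult.assoc jq)
  have "X * star S * q = Y"
    unfolding X_def Y_def S_def q_def pc_in_singleton sum_distrib_right
    by (rule sum.cong[OF HOL.refl]) (simp add: mult.assoc jump_branches(2)[unfolded mult.assoc])
  hence yq: "y * q = q * Y" by (simp add: y_def b_def mult.assoc)
  \<comment> \<open>Every iteration of \<open>Y\<close> ends at \<open>t\<close>, so
    \<open>q\<close> may be inserted before the next one.\<close>
  have "q * star Y = q * star (q * Y)"
    by (rule star_restrict) (simp_all add: mult_left_eq qq mult.assoc Yq)
  moreover have "star y * q = q * star (q * Y)"
    using star_sliding[of q y] by (simp add: qy yq)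
  ultimately have yY: "star y * q = q * star Y" by simp
  have "jump t * star (b + (F + S)) * neg E = jump t * star (b + S + F) * neg E"
    by (simp add: add_ac)
  also have "\<dots> = jump t * star (S + b) * F"
    by (simp add: star semiring_class.distrib_left semiring_class.distrib_right mult.assoc[symmetric]
        stay) (simp add: mult.assoc FnE add.commute)
  also have "\<dots> = jump t * star y * F"
    by (simp add: star_add y_def mult.assoc[symmetric] jS)
  also have "\<dots> = jump t * (star y * q) * (e' * jump f)"
    by (simp add: F_def mult.assoc)
  also have "\<dots> = jump t * (star Y * e') * jump f"
    unfolding yY by (simp add: mult.assoc mult_left_eq[OF jq])
  finally have "jump t * star (b + (F + S)) * neg E = jump t * (star Y * e') * jump f" .
  moreover have "b * pc_in (insert f (insert t U)) = b" "S * pc_in (insert f (insert t U)) = S"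
    using fin bE SE unfolding E_def by (auto elim!: superset_pc_in)
  moreover have "F * pc_in (insert f (insert t U)) = F"
    using fin by (simp add: F_def mult.assoc jump_pc_in)
  ultimately show ?thesis
    using fin U assms(2) Eb EF ES
    by (simp add: implements_def U_def[symmetric] S_def[symmetric] X_def[symmetric]
        Y_def[symmetric] pc_in_singleton[symmetric] q_def[symmetric] b_def[symmetric]
        F_def[symmetric] E_def[symmetric]
        semiring_class.distrib_left semiring_class.distrib_right)
qed

end

section \<open>Values of translated programs and of normal form bodies\<close>

lemma keval_ksum: "keval T A (ksum xs) = (\<Sum>x \<leftarrow> xs. keval T A x)"
  by (induction xs) (simp_all add: ksum_def)

lemma C_If: "C (If n gcs) = body gcs"
  by (simp add: keval_ksum body_def comp_def case_prod_unfold)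

lemma C_Do: "C (Do n gcs) = star (body gcs) * neg (B (enab gcs))"
  by (simp add: keval_ksum body_def comp_def case_prod_unfold)

lemma C_goto: "C (goto pc n) = jump n"
  by (simp add: goto_def jump_def)

lemma body_append: "body (gcs @ gcs') = body gcs + body gcs'"
  by (simp add: body_def)

lemma body_nth: "body gcs = (\<Sum>i<length gcs. B (fst (gcs ! i)) * C (snd (gcs ! i)))"
  by (simp add: body_def sum_list_sum_nth case_prod_unfold atLeast0LessThan)

lemma body_concat: "body (concat gs) = (\<Sum>i<length gs. body (gs ! i))"
proof -
  have "body (concat gs) = (\<Sum>g \<leftarrow> gs. body g)"
    by (induction gs) (simp_all add: body_append, simp add: body_def)
  thus ?thesis by (simp add: sum_list_sum_nth atLeast0LessThan)
qed

lemma body_branches: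
  "body (branches pc n gcs)
    = B (at pc n) * (\<Sum>i<length gcs. B (fst (gcs ! i)) * jump (lab (snd (gcs ! i))))"
  by (simp add: body_nth branches_def sum_distrib_left case_prod_unfold C_goto mult.assoc)

text \<open>Semantic counterpart of \<open>enab\<close> that is also meaningful for empty
  lists.\<close>

definition enabled :: "('v, 'f, 'r) gcs \<Rightarrow> 'v store \<Rightarrow> bool" where
  "enabled gcs s \<longleftrightarrow> (\<exists>(e, d) \<in> set gcs. bval I J e s)"

lemma enabled_append: "enabled (gcs @ gcs') s \<longleftrightarrow> enabled gcs s \<or> enabled gcs' s"
  by (auto simp: enabled_def)

lemma enabled_branches: "enabled (branches pc n gcs) s \<longleftrightarrow> s pc = n \<and> enabled gcs s"
  by (force simp: enabled_def branches_def)

lemma enabled_concat: "enabled (concat gs) s \<longleftrightarrow> (\<exists>i<length gs. enabled (gs ! i) s)"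
proof -
  have "enabled (concat gs) s \<longleftrightarrow> (\<exists>g \<in> set gs. enabled g s)" by (auto simp: enabled_def)
  thus ?thesis by (metis in_set_conv_nth)
qed

text \<open>The claim on \<open>enabled\<close> is carried through the induction so that the guard
  of the final loop can be identified with membership of \<open>pc\<close> in \<open>labs c\<close>;
  nonemptiness makes \<open>enab gcs\<close> meaningful.\<close>

lemma nf_implements:
  assumes "nf pc c f gcs" "well_formed I J c" "distinct (label_list c)" "f \<notin> labs c"
  shows "gcs \<noteq> [] \<and> (\<forall>s. enabled gcs s \<longleftrightarrow> s pc \<in> labs c) \<and>
    implements (body gcs) (labs c) (lab c) f (C (add pc c))"
  using assms
proof (induction rule: nf.induct)
  case (nf_Skip n f)
  thus ?case using implements_atom[of n f 1]
    by (simp add: enabled_def body_def labs_def C_goto)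
next
  case (nf_Assign n x e f)
  thus ?case using implements_atom[of n f "A (x, e)"]
    by (simp add: enabled_def body_def labs_def C_goto)
next
  case (nf_Seq c d gcs0 f gcs1)
  have labs: "labs (Seq c d) = labs c \<union> labs d" by (simp add: labs_def)
  have d: "labs c \<inter> labs d = {}" using nf_Seq.prems by (simp add: labs_def)
  \<comment> \<open>The exit label of \<open>c\<close> is the entry of \<open>d\<close>, so the
    induction hypothesis for \<open>c\<close> needs it outside \<open>labs c\<close>.\<close>
  hence "lab d \<notin> labs c" using lab_in_labs[of d] by blast
  with nf_Seq d show ?case
    by (auto simp: labs enabled_append body_append intro!: implements_seq)
next
  case (nf_If f gcs gs n)
  let ?k = "length gcs"
  have len: "length gs = ?k" using nf_If by (simp add: list_all2_lengthD[symmetric])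
  have dist: "distinct (n # concat (map (\<lambda>(e, d). label_list d) gcs))"
    using nf_If.prems by simp
  note disj = labs_branches_disjoint[OF dist]
  have IH: "gs ! i \<noteq> [] \<and> (\<forall>s. enabled (gs ! i) s \<longleftrightarrow> s pc \<in> labs (snd (gcs ! i))) \<and>
      implements (body (gs ! i)) (labs (snd (gcs ! i))) (lab (snd (gcs ! i))) f
        (C (add pc (snd (gcs ! i))))" if i: "i < ?k" for i
  proof -
    have "well_formed I J (snd (gcs ! i))"
      using nf_If.prems nth_mem[OF i] by (auto simp: case_prod_unfold)
    moreover have "f \<notin> labs (snd (gcs ! i))" using nf_If.prems i by (auto simp: labs_compound)
    ultimately show ?thesis
      using list_all2_nthD[OF nf_If.IH, of i] i disj(1)[OF i] by simp
  qed
  have "implements (body (branches pc n gcs @ concat gs)) (labs (If n gcs)) n f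
      (jump n * (\<Sum>i<?k. B (fst (gcs ! i)) * C (add pc (snd (gcs ! i)))))"
    unfolding body_append body_branches body_concat labs_compound len
    by (rule implements_if) (use IH disj nf_If.prems in \<open>auto simp: labs_compound\<close>)
  moreover have "C (add pc (If n gcs))
      = jump n * (\<Sum>i<?k. B (fst (gcs ! i)) * C (add pc (snd (gcs ! i))))"
    by (simp add: C_goto C_If body_nth case_prod_unfold del: kat_com.simps(4))
  \<comment> \<open>Well-formedness: some dispatch guard holds whenever \<open>pc\<close> is
    \<open>n\<close>, so the body cannot stop at \<open>n\<close>.\<close>
  moreover have "enabled gcs s" for s
    using nf_If.prems by (simp add: enabled_def bval_enab[symmetric])
  hence "enabled (branches pc n gcs @ concat gs) s \<longleftrightarrow> s pc \<in> labs (If n gcs)" for s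
    using IH by (auto simp: enabled_append enabled_branches enabled_concat len labs_compound)
  moreover have "branches pc n gcs \<noteq> []" using nf_If.prems by (simp add: branches_def)
  ultimately show ?case by simp
next
  case (nf_Do n gcs gs f)
  let ?k = "length gcs"
  let ?exit = "[(BAnd (at pc n) (BNot (enab gcs)), goto pc f)]"
  have len: "length gs = ?k" using nf_Do by (simp add: list_all2_lengthD[symmetric])
  have dist: "distinct (n # concat (map (\<lambda>(e, d). label_list d) gcs))"
    using nf_Do.prems by simp
  note disj = labs_branches_disjoint[OF dist]
  have IH: "gs ! i \<noteq> [] \<and> (\<forall>s. enabled (gs ! i) s \<longleftrightarrow> s pc \<in> labs (snd (gcs ! i))) \<and>
      implements (body (gs ! i)) (labs (snd (gcs ! i))) (lab (snd (gcs ! i))) n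
        (C (add pc (snd (gcs ! i))))" if i: "i < ?k" for i
  proof -
    have "well_formed I J (snd (gcs ! i))"
      using nf_Do.prems nth_mem[OF i] by (auto simp: case_prod_unfold)
    thus ?thesis
      using list_all2_nthD[OF nf_Do.IH, of i] i disj(1,2)[OF i] by simp
  qed
  have exit: "body ?exit = B (at pc n) * (neg (B (enab gcs)) * jump f)"
    by (simp add: body_def C_goto mult.assoc)
  have "implements (body (branches pc n gcs @ ?exit @ concat gs)) (labs (Do n gcs)) n f
      (jump n * (star (\<Sum>i<?k. B (fst (gcs ! i)) * (C (add pc (snd (gcs ! i))) * jump n))
        * neg (B (enab gcs))))"
    unfolding body_append body_branches body_concat labs_compound len exit
    by (rule implements_do) (use IH disj nf_Do.prems in \<open>auto simp: labs_compound\<close>)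
  moreover have "enab (map (\<lambda>(e, d). (e, Seq (add pc d) (goto pc n))) gcs) = enab gcs"
    by (simp add: enab_def comp_def case_prod_unfold)
  hence "C (add pc (Do n gcs))
      = jump n * (star (\<Sum>i<?k. B (fst (gcs ! i)) * (C (add pc (snd (gcs ! i))) * jump n))
        * neg (B (enab gcs)))"
    by (simp add: C_goto C_Do body_nth case_prod_unfold del: kat_com.simps(5))
  \<comment> \<open>The exit guard complements the dispatch guards, so at \<open>n\<close> some
    guard always holds.\<close>
  moreover have enabled_exit: "enabled ?exit s \<longleftrightarrow> s pc = n \<and> \<not> enabled gcs s" for s
    using nf_Do.prems by (simp add: enabled_def bval_enab)
  have "enabled (branches pc n gcs @ ?exit @ concat gs) s \<longleftrightarrow> s pc \<in> labs (Do n gcs)" for s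
    unfolding enabled_append enabled_branches enabled_concat enabled_exit len labs_compound
    using IH by auto
  ultimately show ?case by simp
qed

text \<open>Gives the label test a syntactic form, so that \<open>B_cong\<close> can compare it with
  \<open>enab gcs\<close>.\<close>

lemma B_labels: "ns \<noteq> [] \<Longrightarrow> B (disj (map (at pc) ns)) = pc_in (set ns)"
  by (induction ns rule: induct_list012) (simp_all add: pc_in_insert pc_in_singleton)

text \<open>Once the loop guard is the test for \<open>labs c\<close>, the last clause of
  \<open>implements\<close> is the claimed equation.\<close>

theorem normal_form_sound:
  assumes "well_formed I J c" "okf c f" "nf pc c f gcs"
  shows "C (Seq (goto pc (lab c)) (Do 0 gcs)) = C (Seq (add pc c) (goto pc f))"
proof -
  have gcs: "gcs \<noteq> []" "\<And>s. enabled gcs s \<longleftrightarrow> s pc \<in> labs c"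
    and impl: "implements (body gcs) (labs c) (lab c) f (C (add pc c))"
    using nf_implements[OF assms(3,1)] assms(2) by (auto simp: okf_def)
  have ns: "label_list c \<noteq> []" using lab_in_labs[of c] by (auto simp: labs_def)
  have "B (enab gcs) = B (disj (map (at pc) (label_list c)))"
    using gcs ns by (intro B_cong) (auto simp: bval_enab bval_disj enabled_def labs_def)
  also have "\<dots> = pc_in (labs c)" using ns by (simp add: B_labels labs_def)
  finally show ?thesis using impl
    by (simp add: C_goto C_Do implements_def mult.assoc del: kat_com.simps(5))
qed

end

section \<open>Transfer to derivability\<close>

primrec ksubst :: "('t \<Rightarrow> ('t, 'a) kat) \<Rightarrow> ('a \<Rightarrow> ('t, 'a) kat) \<Rightarrow> ('t, 'a) kat \<Rightarrow> ('t, 'a) kat"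
where
  "ksubst t a (KTest p) = t p"
| "ksubst t a (KAct x) = a x"
| "ksubst t a KZero = KZero"
| "ksubst t a KOne = KOne"
| "ksubst t a (KPlus x y) = KPlus (ksubst t a x) (ksubst t a y)"
| "ksubst t a (KSeq x y) = KSeq (ksubst t a x) (ksubst t a y)"
| "ksubst t a (KStar x) = KStar (ksubst t a x)"
| "ksubst t a (KNot x) = KNot (ksubst t a x)"

text \<open>Reduces equations in the term model to derivability at each index.\<close>

lemma keval_kat_fam:
  "keval (\<lambda>p. abs_kat_fam (\<lambda>H. t H p)) (\<lambda>x. abs_kat_fam (\<lambda>H. a H x)) y
    = abs_kat_fam (\<lambda>H. ksubst (t H) (a H) y)"
  by (induction y) (simp_all add: kat_fam_abs_eqs)

lemma KPlus_KZero: "H \<turnstile> KPlus KZero x \<approx> x"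
  by (rule kat_derivable.trans[OF plus_comm plus_zero])

lemma KNot_KZero: "H \<turnstile> KNot KZero \<approx> KOne"
  by (rule kat_derivable.trans[OF kat_derivable.sym[OF KPlus_KZero]])
    (intro test_compl_plus is_test.intros)

lemma KNot_KOne: "H \<turnstile> KNot KOne \<approx> KZero"
  by (rule kat_derivable.trans[OF kat_derivable.sym[OF one_seq]])
    (intro test_compl_seq is_test.intros)

text \<open>Truth values at a fixed store collapse a test by the KAT axioms alone; this serves the
  indices other than \<open>Hyp I J\<close>.\<close>

lemma ksubst_bval:
  "H \<turnstile> ksubst (\<lambda>p. if pval I J p s then KOne else KZero) a (kat_bexp e)
    \<approx> (if bval I J e s then KOne else KZero)"
proof (induction e)
  case (BAnd e e')
  show ?case unfolding kat_bexp.simps ksubst.simps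
    by (rule kat_derivable.trans[OF cong_seq[OF BAnd.IH]]) (auto intro: one_seq zero_seq)
next
  case (BOr e e')
  show ?case unfolding kat_bexp.simps ksubst.simps
    by (rule kat_derivable.trans[OF cong_plus[OF BOr.IH]])
      (auto intro: plus_zero plus_idem KPlus_KZero)
next
  case (BNot e)
  show ?case unfolding kat_bexp.simps ksubst.simps
    by (rule kat_derivable.trans[OF cong_not[OF BNot.IH]]) (auto intro: KNot_KZero KNot_KOne)
qed (simp add: kat_derivable.refl)

text \<open>Away from the given hypotheses, tests are evaluated in a fixed store and actions are 0,
  which satisfies \<open>Hyp I J\<close> in every KAT.\<close>

definition hyp_test ::
    "('f \<Rightarrow> int list \<Rightarrow> int) \<Rightarrow> ('r \<Rightarrow> int list \<Rightarrow> bool) \<Rightarrow>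
     (('v, 'f, 'r) kexp \<times> ('v, 'f, 'r) kexp) set \<Rightarrow> ('v, 'f, 'r) prim \<Rightarrow> ('v, 'f, 'r) kexp" where
  "hyp_test I J H p =
     (if H = Hyp I J then KTest p else if pval I J p (\<lambda>_. 0) then KOne else KZero)"

definition hyp_act ::
    "('f \<Rightarrow> int list \<Rightarrow> int) \<Rightarrow> ('r \<Rightarrow> int list \<Rightarrow> bool) \<Rightarrow>
     (('v, 'f, 'r) kexp \<times> ('v, 'f, 'r) kexp) set \<Rightarrow> 'v \<times> ('v, 'f) iexp \<Rightarrow> ('v, 'f, 'r) kexp" where
  "hyp_act I J H x = (if H = Hyp I J then KAct x else KZero)"

lemma ksubst_hyp: "ksubst (hyp_test I J (Hyp I J)) (hyp_act I J (Hyp I J)) x = x"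
  by (induction x) (simp_all add: hyp_test_def hyp_act_def)

text \<open>At the index \<open>Hyp I J\<close> the substitution is the identity and each hypothesis
  derives itself. Elsewhere a test false in every store evaluates to 0, and the zero action
  annihilates the assignment hypotheses.\<close>

lemma kat_model_fam:
  fixes I :: "'f \<Rightarrow> int list \<Rightarrow> int" and J :: "'r \<Rightarrow> int list \<Rightarrow> bool"
  shows "kat_model I J (\<lambda>p :: ('v, 'f, 'r) prim. abs_kat_fam (\<lambda>H. hyp_test I J H p))
    (\<lambda>x. abs_kat_fam (\<lambda>H. hyp_act I J H x))" (is "kat_model I J ?t ?a")
proof
  show "test (?t p)" for p
    unfolding test_kat_fam_iff hyp_test_def
    by (intro exI conjI HOL.refl) (auto intro: is_test.intros)
next
  fix x y :: "('v, 'f, 'r) kexp"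
  assume xy: "(x, y) \<in> Hyp I J"
  have "H \<turnstile> ksubst (hyp_test I J H) (hyp_act I J H) x
    \<approx> ksubst (hyp_test I J H) (hyp_act I J H) y" for H
  proof (cases "H = Hyp I J")
    case True
    thus ?thesis using xy by (simp add: ksubst_hyp kat_derivable.hyp)
  next
    case False
    hence H: "hyp_test I J H = (\<lambda>p. if pval I J p (\<lambda>_. 0) then KOne else KZero)"
      "hyp_act I J H = (\<lambda>x. KZero)"
      by (auto simp: hyp_test_def hyp_act_def)
    from xy consider (bexp) e where "x = kat_bexp e" "y = KZero" "\<forall>s. \<not> bval I J e s"
      | (assign) v e e0 e1 where "y = KZero"
        "x = KSeq (KSeq (kat_bexp e0) (KAct (v, e))) (KNot (kat_bexp e1))"
      unfolding Hyp_def by blast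
    thus ?thesis
    proof cases
      case bexp
      thus ?thesis using ksubst_bval[of H I J "\<lambda>_. 0" "\<lambda>x. KZero" e] by (simp add: H)
    next
      case assign
      show ?thesis unfolding assign H ksubst.simps
        by (rule kat_derivable.trans[OF cong_seq[OF seq_zero kat_derivable.refl] zero_seq])
    qed
  qed
  thus "keval ?t ?a x = keval ?t ?a y"
    by (simp add: keval_kat_fam kat_fam.abs_eq_iff fam_eq_def)
qed

theorem theorem5p22:
  fixes I :: "'f \<Rightarrow> int list \<Rightarrow> int"
    and J :: "'r \<Rightarrow> int list \<Rightarrow> bool"
    and c :: "('v, 'f, 'r) com"
    and gcs :: "('v, 'f, 'r) gcs"
    and pc :: 'v
    and f n :: int
  assumes "well_formed I J c"
    and "okf c f"
    and "pc \<notin> vars_com c"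
    and "nf pc c f gcs"
    and "n = lab c"
  shows "com_equiv I J (Seq (goto pc n) (Do 0 gcs)) (Seq (add pc c) (goto pc f))"
proof -
  interpret kat_model I J "\<lambda>p. abs_kat_fam (\<lambda>H. hyp_test I J H p)"
    "\<lambda>x. abs_kat_fam (\<lambda>H. hyp_act I J H x)" pc
    by (rule kat_model_fam)
  \<comment> \<open>Reading the model equation at the index \<open>Hyp I J\<close> gives the
    derivation.\<close>
  show ?thesis
    using normal_form_sound[OF assms(1,2,4)]
    unfolding keval_kat_fam kat_fam.abs_eq_iff fam_eq_def com_equiv_def assms(5)
    by (metis ksubst_hyp)
qed

end
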